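(* Let $S$ be a numerical semigroup with conductor $c(S)$, and let $m,n\ge 1$ be integers. Define $m_1:=0$ and $m_i:=\min\{s\in S : s\ge m_{i-1}+m\}$ for $2\le i\le n$, and let $$D_A:=\{c(S),c(S)+1,\ldots,c(S)+m-1\},\qquad D_B:=\{m_1,m_2,\ldots,m_n\}.$$ Put $\mu_i:=m_{i+1}-m_i-m$ for $1\le i\le n-1$. Then $D_A,D_B$ is a solution to the AG polynomial code problem (for $S$, $m$, $n$), and its recovery threshold is $$\max(D_A)+\max(D_B)+1=c(S)+mn+\sum_{i=1}^{n-1}\mu_i.$$ Moreover, if $m\in S$, then $\mu_i=0$ for every $i$ and the recovery threshold equals $c(S)+mn$.
   Context: $\mathbb{N}=\{0,1,2,\dots\}$. A numerical semigroup is a set $S\subseteq\mathbb{N}$ with $0\in S$, closed under addition, and with $\mathbb{N}\setminus S$ finite. Its conductor is $c(S)=\min\{s\in S : \text{every integer } x\ge s\text{ lies in }S\}$. Given $m,n\ge1$, a pair $D_A,D_B\subseteq S$ is a solution to the AG polynomial code problem if $|D_A|=m$, $|D_B|=n$, and $a+b\neq a'+b'$ for all distinct pairs $(a,b),(a',b')\in D_A\times D_B$. Its recovery threshold is $\max(D_A)+\max(D_B)+1$. *)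

theory Defs
  imports Main
begin

definition numerical_semigroup :: "nat set \<Rightarrow> bool" where
  "numerical_semigroup S \<longleftrightarrow>
     0 \<in> S \<and> (\<forall>x\<in>S. \<forall>y\<in>S. x + y \<in> S) \<and> finite (UNIV - S)"

definition conductor :: "nat set \<Rightarrow> nat" where
  "conductor S = (LEAST s. s \<in> S \<and> (\<forall>x\<ge>s. x \<in> S))"

text \<open>Finiteness is explicit because \<^const>\<open>card\<close> is 0 on infinite sets; for
  \<open>m, n \<ge> 1\<close> it already follows from the cardinality conditions.\<close>

definition ag_code_solution :: "nat set \<Rightarrow> nat \<Rightarrow> nat \<Rightarrow> nat set \<Rightarrow> nat set \<Rightarrow> bool" where
  "ag_code_solution S m n D\<^sub>A D\<^sub>B \<longleftrightarrow>
     D\<^sub>A \<subseteq> S \<and> D\<^sub>B \<subseteq> S \<and>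
     finite D\<^sub>A \<and> card D\<^sub>A = m \<and> finite D\<^sub>B \<and> card D\<^sub>B = n \<and>
     (\<forall>(a, b) \<in> D\<^sub>A \<times> D\<^sub>B. \<forall>(a', b') \<in> D\<^sub>A \<times> D\<^sub>B.
        (a, b) \<noteq> (a', b') \<longrightarrow> a + b \<noteq> a' + b')"

definition recovery_threshold :: "nat set \<Rightarrow> nat set \<Rightarrow> nat" where
  "recovery_threshold D\<^sub>A D\<^sub>B = Max D\<^sub>A + Max D\<^sub>B + 1"

end

(* Consecutive elements of D_B are at least m apart while D_A is an interval of length m, so the
   translates b + D_A for b in D_B are pairwise disjoint. The threshold is a telescoping sum. *)
theory Submission
  imports Defs
begin

text \<open>Each step of the sequence \<open>ms\<close> advances by at least \<open>m\<close>, so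
  any two of its terms differ by at least \<open>m\<close> (\<open>gap_le\<close>), whereas two
  elements of the interval \<open>D\<^sub>A\<close> differ by at most m - 1. Hence a + b = a' + b'
  forces b = b', and then a = a'. As \<open>ms\<close> increases from 0, its largest term is
  \<open>ms n\<close>, and telescoping the excesses \<mu> gives ms n = (n - 1) m + sum of \<mu>;
  adding the contribution c + m of \<open>D\<^sub>A\<close> yields the threshold. If m lies in S,
  closure under addition makes each minimum attained at its lower bound, so every excess vanishes.
  Cofiniteness of S makes all the minima exist (\<open>conductor_le_imp_mem\<close>,
  \<open>Least_semigroup_ge\<close>).\<close>

lemma numerical_semigroup_cofinite:
  assumes "numerical_semigroup S"
  obtains N where "\<And>x. x \<ge> N \<Longrightarrow> x \<in> S"
proof -
  have "finite (UNIV - S)"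
    using assms by (simp add: numerical_semigroup_def)
  then obtain N where "\<forall>x\<in>UNIV - S. x < N"
    using finite_nat_set_iff_bounded by blast
  then have "x \<in> S" if "x \<ge> N" for x
    using that by (meson DiffI UNIV_I not_less)
  then show ?thesis using that by blast
qed

lemma conductor_le_imp_mem:
  assumes "numerical_semigroup S" "conductor S \<le> x"
  shows "x \<in> S"
proof -
  obtain N where "\<And>x. x \<ge> N \<Longrightarrow> x \<in> S"
    using numerical_semigroup_cofinite[OF assms(1)] by blast
  then have "N \<in> S \<and> (\<forall>x\<ge>N. x \<in> S)"
    by auto
  then have "conductor S \<in> S \<and> (\<forall>x\<ge>conductor S. x \<in> S)"
    unfolding conductor_def by (rule LeastI)
  then show ?thesis using assms(2) by blast
qed

text \<open>\<open>LEAST\<close> says nothing without a witness; cofiniteness provides one above any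
  bound \<open>k\<close>.\<close>

lemma Least_semigroup_ge:
  assumes "numerical_semigroup S"
  shows "(LEAST s. s \<in> S \<and> s \<ge> k) \<in> S" and "(LEAST s. s \<in> S \<and> s \<ge> k) \<ge> k"
proof -
  obtain N where "\<And>x. x \<ge> N \<Longrightarrow> x \<in> S"
    using numerical_semigroup_cofinite[OF assms] by blast
  then have "max N k \<in> S \<and> max N k \<ge> k"
    by auto
  then have "(LEAST s. s \<in> S \<and> s \<ge> k) \<in> S \<and> (LEAST s. s \<in> S \<and> s \<ge> k) \<ge> k"
    by (rule LeastI)
  then show "(LEAST s. s \<in> S \<and> s \<ge> k) \<in> S" and "(LEAST s. s \<in> S \<and> s \<ge> k) \<ge> k"
    by auto
qed

text \<open>Induction on \<open>j\<close>: the step ending at \<open>j = i + 1\<close> supplies the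
  gap, and later steps only increase \<open>f\<close>.\<close>

lemma gap_le:
  fixes f :: "nat \<Rightarrow> nat"
  assumes "\<And>i. 1 \<le> i \<Longrightarrow> i < n \<Longrightarrow> f i + m \<le> f (Suc i)"
    and "1 \<le> i" "i < j" "j \<le> n"
  shows "f i + m \<le> f j"
  using \<open>i < j\<close> \<open>j \<le> n\<close>
proof (induction j)
  case 0
  then show ?case by simp
next
  case (Suc j)
  have step: "f j + m \<le> f (Suc j)"
    using assms(1)[of j] assms(2) Suc.prems by simp
  show ?case
  proof (cases "i = j")
    case True
    then show ?thesis using step by simp
  next
    case False
    then show ?thesis using Suc step by simp
  qed
qed

theorem mainTheorem4:
  fixes S D\<^sub>A D\<^sub>B :: "nat set" and m n :: nat
    and ms :: "nat \<Rightarrow> nat" and \<mu> :: "nat \<Rightarrow> int"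
  assumes "numerical_semigroup S"
    and "m \<ge> 1" and "n \<ge> 1"
    and "ms 1 = 0"
    and "\<And>i. 2 \<le> i \<Longrightarrow> i \<le> n \<Longrightarrow> ms i = (LEAST s. s \<in> S \<and> s \<ge> ms (i - 1) + m)"
    and "D\<^sub>A = {conductor S..conductor S + m - 1}"
    and "D\<^sub>B = ms ` {1..n}"
    and "\<And>i. 1 \<le> i \<Longrightarrow> i \<le> n - 1 \<Longrightarrow> \<mu> i = int (ms (i + 1)) - int (ms i) - int m"
  shows "ag_code_solution S m n D\<^sub>A D\<^sub>B
    \<and> int (recovery_threshold D\<^sub>A D\<^sub>B)
        = int (conductor S) + int m * int n + (\<Sum>i = 1..n - 1. \<mu> i)
    \<and> (m \<in> S \<longrightarrow>
        (\<forall>i\<in>{1..n - 1}. \<mu> i = 0) \<and> recovery_threshold D\<^sub>A D\<^sub>B = conductor S + m * n)"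
proof -
  let ?c = "conductor S"
  note ms_rec = assms(5) and \<mu>_eq = assms(8)
  have ms_Suc: "ms (Suc i) = (LEAST s. s \<in> S \<and> s \<ge> ms i + m)" if "1 \<le> i" "i < n" for i
    using ms_rec[of "Suc i"] that by simp
  have ms_mem: "ms i \<in> S" if "i \<in> {1..n}" for i
  proof (cases "i = 1")
    case True
    then show ?thesis using assms(1,4) by (simp add: numerical_semigroup_def)
  next
    case False
    then have "2 \<le> i" "i \<le> n" using that by auto
    then show ?thesis using ms_rec Least_semigroup_ge(1)[OF assms(1)] by simp
  qed
  have gap: "ms i + m \<le> ms j" if "1 \<le> i" "i < j" "j \<le> n" for i j
    using gap_le[of n ms m i j] that ms_Suc Least_semigroup_ge(2)[OF assms(1)] by simp
  have inj: "inj_on ms {1..n}"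
  proof (rule linorder_inj_onI)
    show "ms i \<noteq> ms j" if "i < j" "i \<in> {1..n}" "j \<in> {1..n}" for i j
      using gap[of i j] that assms(2) by simp
  qed auto
  \<comment> \<open>If the indices differed, \<open>gap\<close> would make \<open>a\<close> and
    \<open>a'\<close> differ by at least \<open>m\<close>, too much for an interval of
    \<open>m\<close> consecutive integers.\<close>
  have disjoint: "i = j" if "i \<in> {1..n}" "j \<in> {1..n}" "a \<in> D\<^sub>A" "a' \<in> D\<^sub>A" "a + ms i = a' + ms j" for i j a a'
  proof (rule ccontr)
    assume "i \<noteq> j"
    then consider "i < j" | "j < i" by linarith
    then show False
      using gap[of i j] gap[of j i] that assms(2,6) by cases auto
  qed
  have solution: "ag_code_solution S m n D\<^sub>A D\<^sub>B"
    unfolding ag_code_solution_def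
  proof (intro conjI)
    show "D\<^sub>A \<subseteq> S"
      using conductor_le_imp_mem[OF assms(1)] assms(6) by auto
    show "D\<^sub>B \<subseteq> S"
      using ms_mem assms(7) by auto
    show "card D\<^sub>B = n"
      using card_image[OF inj] assms(7) by simp
    show "\<forall>(a, b)\<in>D\<^sub>A \<times> D\<^sub>B. \<forall>(a', b')\<in>D\<^sub>A \<times> D\<^sub>B. (a, b) \<noteq> (a', b') \<longrightarrow> a + b \<noteq> a' + b'"
      using disjoint assms(7) by fastforce
  qed (use assms(2,6,7) in auto)
  have "Max D\<^sub>B = ms n"
  proof (rule Max_eqI)
    show "b \<le> ms n" if "b \<in> D\<^sub>B" for b
    proof -
      obtain i where i: "b = ms i" "1 \<le> i" "i \<le> n" using \<open>b \<in> D\<^sub>B\<close> assms(7) by auto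
      then show ?thesis using gap[of i n] by (cases "i = n") auto
    qed
  qed (use assms(3,7) in auto)
  moreover have "Max D\<^sub>A = ?c + m - 1"
    using assms(2,6) by (intro Max_eqI) auto
  \<comment> \<open>Since m \<ge> 1, the truncated \<open>- 1\<close> in
    \<open>Max D\<^sub>A\<close> cancels exactly against the \<open>+ 1\<close> of the
    threshold.\<close>
  ultimately have threshold: "recovery_threshold D\<^sub>A D\<^sub>B = ?c + m + ms n"
    using assms(2) by (simp add: recovery_threshold_def)
  have "(\<Sum>i = 1..n - 1. \<mu> i) = (\<Sum>i = 1..n - 1. int (ms (Suc i)) - int (ms i) - int m)"
    using \<mu>_eq by (intro sum.cong) auto
  also have "\<dots> = (\<Sum>i = 1..n - 1. int (ms (Suc i)) - int (ms i)) - int (n - 1) * int m"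
    by (simp add: sum_subtractf)
  \<comment> \<open>The sum telescopes to \<open>ms n - ms 1\<close> with \<open>ms 1 = 0\<close>;
    for n = 1 it is empty and both sides are 0.\<close>
  also have "\<dots> = int (ms n) - int (n - 1) * int m"
    using sum_Suc_diff[of 1 "n - 1" "\<lambda>i. int (ms i)"] assms(3,4) by simp
  finally have sum_\<mu>: "int (recovery_threshold D\<^sub>A D\<^sub>B) = int ?c + int m * int n + (\<Sum>i = 1..n - 1. \<mu> i)"
    using threshold assms(3) by (simp add: of_nat_diff algebra_simps)
  have "\<forall>i\<in>{1..n - 1}. \<mu> i = 0" if "m \<in> S"
  proof
    fix i assume i: "i \<in> {1..n - 1}"
    then have "ms i + m \<in> S"
      using ms_mem[of i] that assms(1) by (auto simp: numerical_semigroup_def)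
    \<comment> \<open>The lower bound itself belongs to S, so it is the minimum.\<close>
    then have "(LEAST s. s \<in> S \<and> s \<ge> ms i + m) = ms i + m"
      by (intro Least_equality) auto
    then have "ms (Suc i) = ms i + m"
      using ms_Suc[of i] i by auto
    then show "\<mu> i = 0"
      using \<mu>_eq[of i] i by simp
  qed
  moreover have "recovery_threshold D\<^sub>A D\<^sub>B = ?c + m * n" if "\<forall>i\<in>{1..n - 1}. \<mu> i = 0"
  proof -
    have "int (recovery_threshold D\<^sub>A D\<^sub>B) = int (?c + m * n)"
      using sum_\<mu> that by simp
    then show ?thesis by (simp only: of_nat_eq_iff)
  qed
  ultimately show ?thesis
    using solution sum_\<mu> by blast
qed

end
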